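(* Let $R>0$. There are no parabolic cyclic solutions for the $n$-body problem in $\mathbb{H}^2_R$. That is: for every $n\ge 2$ and all masses $m_1,\dots,m_n>0$, there is no solution $w(t)=(w_1(t),\dots,w_n(t))$ of the equations of motion of the $n$-body problem in $\mathbb{H}^2_R$ with hyperbolic cotangent potential (given in the context) that satisfies $$\dot w_k=1+w_k^2-\frac{(w_k-\bar w_k)^2}{4},\qquad k=1,\dots,n.$$
   Context: $\mathbb{H}^2_R=\{w\in\mathbb{C}: \operatorname{Im} w>0\}$ is the upper half plane with the metric $-ds^2=\frac{4R^2}{(w-\bar w)^2}\,dw\,d\bar w$. The $n$-body problem in $\mathbb{H}^2_R$ with hyperbolic cotangent potential, for masses $m_1,\dots,m_n>0$ and positions $w_1(t),\dots,w_n(t)\in\mathbb{H}^2_R$, is the system, for $k=1,\dots,n$, $$\ddot w_k-\frac{2\dot w_k^2}{w_k-\bar w_k}=-\frac{2(w_k-\bar w_k)^3}{R}\sum_{\substack{j=1\\ j\neq k}}^n\frac{m_j(\bar w_j-w_j)^2(w_k-w_j)(\bar w_j-w_k)}{[\Theta_{(k,j)}(w,\bar w)]^{3/2}},$$ where $$\Theta_{(k,j)}(w,\bar w)=[(\bar w_k+w_k)(\bar w_j+w_j)-2(|w_k|^2+|w_j|^2)]^2-(\bar w_k-w_k)^2(\bar w_j-w_j)^2,$$ whose zero set is the singular (collision) set; a solution is defined on an open time interval and stays off the singular set, i.e. $w_k(t)\ne w_j(t)$ for $k\neq j$. A parabolic cyclic solution is a solution of this system that moves along (is invariant under) the flow of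 the vector field $\dot w=1+w^2-\frac{(w-\bar w)^2}{4}$, i.e. each component $w_k(t)$ satisfies this differential equation. In real coordinates $w=u+iv$ the vector field is $\dot u=1+u^2$, $\dot v=2uv$. *)

theory Defs
  imports "HOL-Analysis.Analysis"
begin

definition upper_half_plane :: "complex set" where
  "upper_half_plane = {w. Im w > 0}"

definition Theta :: "complex \<Rightarrow> complex \<Rightarrow> complex" where
  "Theta wk wj =
     ((cnj wk + wk) * (cnj wj + wj)
        - 2 * ((complex_of_real (cmod wk))\<^sup>2 + (complex_of_real (cmod wj))\<^sup>2))\<^sup>2
     - (cnj wk - wk)\<^sup>2 * (cnj wj - wj)\<^sup>2"

text \<open>
  On the upper half plane \<^const>\<open>Theta\<close> is a nonnegative real number that vanishes exactly at
  collisions. Hence, off collisions, its principal complex power with exponent 3/2 (used in the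
  equations of motion below) is the usual positive real power.
\<close>

lemma Theta_eq_of_real:
  "Theta a b = complex_of_real
     (4 * (cmod (a - b))\<^sup>2 * (cmod (a - cnj b))\<^sup>2)"
proof -
  have norms: "(complex_of_real (cmod z))\<^sup>2 = complex_of_real ((Re z)\<^sup>2 + (Im z)\<^sup>2)" for z
    by (metis cmod_power2 of_real_power)
  show ?thesis
    unfolding Theta_def norms cmod_power2
    by (simp add: complex_eq_iff power2_eq_square algebra_simps)
qed

lemma Theta_eq_0_iff:
  assumes "a \<in> upper_half_plane" "b \<in> upper_half_plane"
  shows "Theta a b = 0 \<longleftrightarrow> a = b"
proof -
  have "a \<noteq> cnj b"
    using assms by (auto simp: upper_half_plane_def complex_eq_iff)
  then show ?thesis
    by (simp add: Theta_eq_of_real)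
qed

lemma Theta_powr:
  "Theta a b powr (3/2) = complex_of_real (Re (Theta a b) powr (3/2))"
  using powr_of_real[of "Re (Theta a b)" "3/2"] by (simp add: Theta_eq_of_real)

definition nbody_rhs ::
    "real \<Rightarrow> nat \<Rightarrow> (nat \<Rightarrow> real) \<Rightarrow> (nat \<Rightarrow> complex) \<Rightarrow> nat \<Rightarrow> complex" where
  "nbody_rhs R n m w k =
     - (2 * (w k - cnj (w k)) ^ 3 / complex_of_real R) *
       (\<Sum>j\<in>{1..n} - {k}.
          complex_of_real (m j) * (cnj (w j) - w j)\<^sup>2 * (w k - w j) * (cnj (w j) - w k)
            / Theta (w k) (w j) powr (3/2))"

text \<open>
  The \<open>k\<close>-th body (\<open>1 \<le> k \<le> n\<close>) has mass \<open>m k\<close> and position \<open>w k t\<close> at time \<open>t\<close>; values of \<open>m\<close>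
  and \<open>w\<close> at other indices are irrelevant.
\<close>

definition nbody_solution ::
    "real \<Rightarrow> nat \<Rightarrow> (nat \<Rightarrow> real) \<Rightarrow> real set \<Rightarrow> (nat \<Rightarrow> real \<Rightarrow> complex) \<Rightarrow> bool" where
  "nbody_solution R n m I w \<longleftrightarrow>
     open I \<and> is_interval I \<and> I \<noteq> {} \<and>
     (\<forall>t\<in>I. \<forall>k\<in>{1..n}. w k t \<in> upper_half_plane) \<and>
     (\<forall>t\<in>I. \<forall>k\<in>{1..n}. \<forall>j\<in>{1..n}. k \<noteq> j \<longrightarrow> w k t \<noteq> w j t) \<and>
     (\<exists>w' w'' :: nat \<Rightarrow> real \<Rightarrow> complex. \<forall>t\<in>I. \<forall>k\<in>{1..n}.
        (w k has_vector_derivative w' k t) (at t) \<and>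
        (w' k has_vector_derivative w'' k t) (at t) \<and>
        w'' k t - 2 * (w' k t)\<^sup>2 / (w k t - cnj (w k t)) = nbody_rhs R n m (\<lambda>i. w i t) k)"

definition parabolic_cyclic_field :: "complex \<Rightarrow> complex" where
  "parabolic_cyclic_field w = 1 + w\<^sup>2 - (w - cnj w)\<^sup>2 / 4"

definition parabolic_cyclic_solution ::
    "real \<Rightarrow> nat \<Rightarrow> (nat \<Rightarrow> real) \<Rightarrow> real set \<Rightarrow> (nat \<Rightarrow> real \<Rightarrow> complex) \<Rightarrow> bool" where
  "parabolic_cyclic_solution R n m I w \<longleftrightarrow>
     nbody_solution R n m I w \<and>
     (\<forall>t\<in>I. \<forall>k\<in>{1..n}.
        (w k has_vector_derivative parabolic_cyclic_field (w k t)) (at t))"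

end

theory Submission
  imports Defs
begin

text \<open>
  The forces are central, so the components of momentum belonging to the Killing fields \<open>1\<close>
  (translation) and \<open>w\<close> (dilation) are conserved: the covariant accelerations, paired with either
  field and weighted by the masses, sum to zero. Along the parabolic cyclic field this reads
  \<open>\<Sum> m u (1 + u\<^sup>2) / v\<^sup>2 = 0\<close> and \<open>\<Sum> m (1 + u\<^sup>2) (1 - u\<^sup>2 + 2 v\<^sup>2) / v\<^sup>2 = 0\<close>. The time derivative
  of the first sum is \<open>\<Sum> m (1 + u\<^sup>2) (1 - u\<^sup>2) / v\<^sup>2\<close>, so subtracting leaves
  \<open>\<Sum> m (1 + u\<^sup>2) = 0\<close>, which is absurd for positive masses.
\<close>

text \<open>Action equals reaction: antisymmetry makes the diagonal terms vanish, so the sum extends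
  to all pairs, where exchanging the order of summation turns it into its own negative.\<close>

lemma sum_antisymmetric_eq_0:
  fixes f :: "'a \<Rightarrow> 'a \<Rightarrow> real"
  assumes "finite A" and anti: "\<And>k j. f k j = - f j k"
  shows "(\<Sum>k\<in>A. \<Sum>j\<in>A - {k}. f k j) = 0"
proof -
  have diag: "f k k = 0" for k
    using anti[of k k] by simp
  have "(\<Sum>j\<in>A - {k}. f k j) = (\<Sum>j\<in>A. f k j)" for k
    by (rule sum.mono_neutral_left) (use assms(1) diag in auto)
  moreover have "(\<Sum>k\<in>A. \<Sum>j\<in>A. f k j) = (\<Sum>k\<in>A. \<Sum>j\<in>A. f j k)"
    by (rule sum.swap)
  moreover have "(\<Sum>k\<in>A. \<Sum>j\<in>A. f j k) = - (\<Sum>k\<in>A. \<Sum>j\<in>A. f k j)"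
    by (simp add: sum_negf[symmetric] anti[symmetric])
  ultimately show ?thesis
    by simp
qed

section \<open>The forces in real coordinates\<close>

lemma Theta_commute: "Theta a b = Theta b a"
  unfolding Theta_def by (simp add: algebra_simps)

text \<open>Two of the three powers of \<open>Im (w k)\<close> in the prefactor of
  \<open>nbody_rhs\<close> are moved into the sum. Together with the square of
  \<open>Im (w j)\<close> already there, they make the scalar factor symmetric in the two
  bodies.\<close>

definition coupling :: "complex \<Rightarrow> complex \<Rightarrow> real" where
  "coupling a b = (Im a)\<^sup>2 * (Im b)\<^sup>2 / Re (Theta a b) powr (3/2)"

lemma coupling_commute: "coupling a b = coupling b a"
  by (simp add: coupling_def Theta_commute mult.commute)

lemma nbody_rhs_eq:
  "nbody_rhs R n m w k =
    \<i> * complex_of_real (64 * Im (w k) / R) *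
      (\<Sum>j\<in>{1..n} - {k}. complex_of_real (m j * coupling (w k) (w j)) *
         ((w k - w j) * (w k - cnj (w j))))"
proof -
  have diff: "z - cnj z = 2 * \<i> * complex_of_real (Im z)"
    "cnj z - z = - 2 * \<i> * complex_of_real (Im z)" for z
    by (simp_all add: complex_eq_iff)
  have cub: "(z - cnj z) ^ 3 = - 8 * \<i> * complex_of_real (Im z ^ 3)" for z
    by (simp add: diff power_mult_distrib power3_eq_cube)
  have sq: "(cnj z - z)\<^sup>2 = - 4 * complex_of_real ((Im z)\<^sup>2)" for z
    by (simp add: diff power_mult_distrib)
  \<comment> \<open>The cube contributes - 8 i, hence the 16 here; the factor - 4 from
    \<open>sq\<close> later raises it to 64, its sign being absorbed by reversing
    \<open>cnj (w j) - w k\<close>.\<close>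
  have prefactor: "- (2 * (w k - cnj (w k)) ^ 3 / complex_of_real R)
      = \<i> * complex_of_real (16 * Im (w k) / R) * complex_of_real ((Im (w k))\<^sup>2)"
    unfolding cub by (simp add: power2_eq_square power3_eq_cube)
  have "complex_of_real ((Im (w k))\<^sup>2) *
      (complex_of_real (m j) * (cnj (w j) - w j)\<^sup>2 * (w k - w j) * (cnj (w j) - w k)
            / Theta (w k) (w j) powr (3/2))
    = 4 * (complex_of_real (m j * coupling (w k) (w j)) *
         ((w k - w j) * (w k - cnj (w j))))" for j
  proof -
    have "a * (c * (- 4 * b) * d * e / q) = 4 * (c * (a * b / q) * (d * - e))"
      for a b c d e q :: complex
      by simp
    from this[of _ _ _ _ "cnj (w j) - w k"] show ?thesis
      unfolding Theta_powr sq coupling_def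
      by (simp only: of_real_mult of_real_divide minus_diff_eq)
  qed
  then have "complex_of_real ((Im (w k))\<^sup>2) *
      (\<Sum>j\<in>{1..n} - {k}.
        complex_of_real (m j) * (cnj (w j) - w j)\<^sup>2 * (w k - w j) * (cnj (w j) - w k)
            / Theta (w k) (w j) powr (3/2))
    = 4 * (\<Sum>j\<in>{1..n} - {k}. complex_of_real (m j * coupling (w k) (w j)) *
         ((w k - w j) * (w k - cnj (w j))))"
    by (simp only: sum_distrib_left)
  then show ?thesis
    unfolding nbody_rhs_def prefactor mult.assoc by simp
qed

lemma Re_nbody_rhs:
  "Re (nbody_rhs R n m w k) =
    - 128 * (Im (w k))\<^sup>2 / R *
      (\<Sum>j\<in>{1..n} - {k}. m j * coupling (w k) (w j) * (Re (w k) - Re (w j)))"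
proof -
  \<comment> \<open>The product is the real quadratic a^2 - 2 (Re b) a + |b|^2, so its imaginary
    part is divisible by \<open>Im a\<close>. This supplies the second power of
    \<open>Im (w k)\<close>.\<close>
  have "Im (complex_of_real c * ((a - b) * (a - cnj b))) = 2 * Im a * (c * (Re a - Re b))"
    for c a b by (simp add: algebra_simps)
  then have "Im (\<Sum>j\<in>{1..n} - {k}. complex_of_real (m j * coupling (w k) (w j)) *
         ((w k - w j) * (w k - cnj (w j))))
    = 2 * Im (w k) *
      (\<Sum>j\<in>{1..n} - {k}. m j * coupling (w k) (w j) * (Re (w k) - Re (w j)))"
    by (simp only: Im_sum sum_distrib_left)
  moreover have "Re (\<i> * complex_of_real c * z) = - c * Im z" for c z
    by simp
  ultimately show ?thesis
    unfolding nbody_rhs_eq by (simp only: power2_eq_square) simp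
qed

lemma Im_nbody_rhs:
  "Im (nbody_rhs R n m w k) =
    64 * Im (w k) / R *
      (\<Sum>j\<in>{1..n} - {k}. m j * coupling (w k) (w j) *
         ((Re (w k) - Re (w j))\<^sup>2 + (Im (w j))\<^sup>2 - (Im (w k))\<^sup>2))"
proof -
  have "Re (complex_of_real c * ((a - b) * (a - cnj b)))
      = c * ((Re a - Re b)\<^sup>2 + (Im b)\<^sup>2 - (Im a)\<^sup>2)"
    for c a b by (simp add: algebra_simps power2_eq_square)
  then have "Re (\<Sum>j\<in>{1..n} - {k}. complex_of_real (m j * coupling (w k) (w j)) *
         ((w k - w j) * (w k - cnj (w j))))
    = (\<Sum>j\<in>{1..n} - {k}. m j * coupling (w k) (w j) *
         ((Re (w k) - Re (w j))\<^sup>2 + (Im (w j))\<^sup>2 - (Im (w k))\<^sup>2))"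
    by (simp only: Re_sum)
  moreover have "Im (\<i> * complex_of_real c * z) = c * Re z" for c z
    by simp
  ultimately show ?thesis
    unfolding nbody_rhs_eq by (simp only:)
qed

section \<open>Momentum balances for translation and dilation\<close>

lemma translation_momentum_balance:
  assumes "\<And>k. k \<in> {1..n} \<Longrightarrow> Im (w k) \<noteq> 0"
  shows "(\<Sum>k\<in>{1..n}. m k * Re (nbody_rhs R n m w k) / (Im (w k))\<^sup>2) = 0"
    (is "(\<Sum>k\<in>_. ?P k) = 0")
proof -
  \<comment> \<open>Division by \<open>(Im (w k))\<^sup>2\<close> is the weight of the hyperbolic
    metric and cancels the same factor in \<open>Re_nbody_rhs\<close>. What remains is symmetric
    except for the difference of real parts.\<close>
  define f where "f k j = - 128 / R * (m k * m j * coupling (w k) (w j) * (Re (w k) - Re (w j)))"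
    for k j
  have "?P k = (\<Sum>j\<in>{1..n} - {k}. f k j)"
    if k: "k \<in> {1..n}" for k
  proof -
    define a where "a j = m j * coupling (w k) (w j) * (Re (w k) - Re (w j))" for j
    have "f k j = - 128 / R * m k * a j" for j
      unfolding f_def a_def by simp
    then have "(\<Sum>j\<in>{1..n} - {k}. f k j) = - 128 / R * m k * sum a ({1..n} - {k})"
      by (simp only: sum_distrib_left)
    then show ?thesis
      using assms[OF k] unfolding Re_nbody_rhs a_def[symmetric] by simp
  qed
  then have "(\<Sum>k\<in>{1..n}. ?P k) = (\<Sum>k\<in>{1..n}. \<Sum>j\<in>{1..n} - {k}. f k j)"
    by (rule sum.cong[OF refl])
  also have "\<dots> = 0"
  proof (rule sum_antisymmetric_eq_0)
    show "f k j = - f j k" for k j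
      unfolding f_def by (simp add: coupling_commute[of "w k"] algebra_simps)
  qed simp
  finally show ?thesis .
qed

lemma dilation_momentum_balance:
  assumes "\<And>k. k \<in> {1..n} \<Longrightarrow> Im (w k) \<noteq> 0"
  shows "(\<Sum>k\<in>{1..n}. m k * (Re (w k) * Re (nbody_rhs R n m w k)
           + Im (w k) * Im (nbody_rhs R n m w k)) / (Im (w k))\<^sup>2) = 0"
    (is "(\<Sum>k\<in>_. ?P k) = 0")
proof -
  \<comment> \<open>With w = u + i v, the two force components combine through (u_k - u_j)^2 + v_j^2
    - v_k^2 - 2 u_k (u_k - u_j) = |w_j|^2 - |w_k|^2, which is again antisymmetric.\<close>
  define f where "f k j = 64 / R * (m k * m j * coupling (w k) (w j) *
      ((Re (w j))\<^sup>2 + (Im (w j))\<^sup>2 - (Re (w k))\<^sup>2 - (Im (w k))\<^sup>2))" for k j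
  have "?P k = (\<Sum>j\<in>{1..n} - {k}. f k j)"
    if k: "k \<in> {1..n}" for k
  proof -
    define a where "a j = m j * coupling (w k) (w j) * (Re (w k) - Re (w j))" for j
    define b where "b j = m j * coupling (w k) (w j) *
      ((Re (w k) - Re (w j))\<^sup>2 + (Im (w j))\<^sup>2 - (Im (w k))\<^sup>2)" for j
    have "f k j = 64 / R * m k * (b j - 2 * Re (w k) * a j)" for j
      unfolding f_def a_def b_def by (simp add: algebra_simps power2_eq_square)
    then have sum_f: "(\<Sum>j\<in>{1..n} - {k}. f k j)
        = 64 / R * m k * (sum b ({1..n} - {k}) - 2 * Re (w k) * sum a ({1..n} - {k}))"
      by (simp only: sum_distrib_left[symmetric] sum_subtractf)
    show ?thesis
      using assms[OF k]
      unfolding sum_f Re_nbody_rhs Im_nbody_rhs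
        a_def[symmetric] b_def[symmetric]
      \<comment> \<open>For R = 0 both sides are 0, because division by zero yields 0.\<close>
      by (cases "R = 0") (simp_all add: field_simps power2_eq_square)
  qed
  then have "(\<Sum>k\<in>{1..n}. ?P k) = (\<Sum>k\<in>{1..n}. \<Sum>j\<in>{1..n} - {k}. f k j)"
    by (rule sum.cong[OF refl])
  also have "\<dots> = 0"
  proof (rule sum_antisymmetric_eq_0)
    show "f k j = - f j k" for k j
      unfolding f_def by (simp add: coupling_commute[of "w k"] algebra_simps)
  qed simp
  finally show ?thesis .
qed

section \<open>Kinematics along the parabolic cyclic field\<close>

lemma parabolic_cyclic_field_simps:
  "Re (parabolic_cyclic_field z) = 1 + (Re z)\<^sup>2"
  "Im (parabolic_cyclic_field z) = 2 * Re z * Im z"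
  by (simp_all add: parabolic_cyclic_field_def power2_eq_square)

text \<open>The formula comes from differentiating u' = 1 + u^2 and v' = 2 u v once more along the
  flow.\<close>

definition parabolic_cyclic_acceleration :: "complex \<Rightarrow> complex" where
  "parabolic_cyclic_acceleration z =
     Complex (2 * Re z * (1 + (Re z)\<^sup>2)) (Im z * (2 + 6 * (Re z)\<^sup>2))"

lemma has_vector_derivative_parabolic_cyclic_field:
  assumes "(z has_vector_derivative parabolic_cyclic_field (z t)) (at t)"
  shows "((\<lambda>s. parabolic_cyclic_field (z s)) has_vector_derivative
           parabolic_cyclic_acceleration (z t)) (at t)"
proof -
  have "((\<lambda>s. 1 + z s * z s - (1/4) * ((z s - cnj (z s)) * (z s - cnj (z s))))
      has_vector_derivative parabolic_cyclic_acceleration (z t)) (at t)"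
    by (rule has_vector_derivative_eq_rhs,
        (rule derivative_intros has_vector_derivative_mult has_vector_derivative_cnj assms)+)
       (simp add: complex_eq_iff parabolic_cyclic_acceleration_def parabolic_cyclic_field_simps
          power2_eq_square field_simps)
  then show ?thesis
    by (simp add: parabolic_cyclic_field_def power2_eq_square)
qed

text \<open>The subtracted term is the connection term of the hyperbolic metric and equals - i w'^2
  / v. Removing it adds - 4 u (1 + u^2) to the real part and (1 + u^2)^2 / v - 4 u^2 v to the
  imaginary part.\<close>

lemma parabolic_cyclic_covariant_acceleration:
  fixes z :: complex
  assumes "Im z \<noteq> 0"
  defines "a \<equiv> parabolic_cyclic_acceleration z - 2 * (parabolic_cyclic_field z)\<^sup>2 / (z - cnj z)"
  shows "Re a = - 2 * Re z * (1 + (Re z)\<^sup>2)"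
    and "Im a = (1 + (Re z)\<^sup>2) * (2 * Im z + (1 + (Re z)\<^sup>2) / Im z)"
proof -
  have diff: "z - cnj z = 2 * \<i> * complex_of_real (Im z)"
    by (simp add: complex_eq_iff)
  have "2 * (parabolic_cyclic_field z)\<^sup>2 / (z - cnj z)
      = - \<i> * (parabolic_cyclic_field z)\<^sup>2 / complex_of_real (Im z)"
    unfolding diff using assms(1) by (simp add: field_simps)
  then have a: "a = parabolic_cyclic_acceleration z
      + \<i> * (parabolic_cyclic_field z)\<^sup>2 / complex_of_real (Im z)"
    unfolding a_def by simp
  show "Re a = - 2 * Re z * (1 + (Re z)\<^sup>2)"
    and "Im a = (1 + (Re z)\<^sup>2) * (2 * Im z + (1 + (Re z)\<^sup>2) / Im z)"
    using assms(1) unfolding a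
    by (simp_all add: parabolic_cyclic_acceleration_def parabolic_cyclic_field_simps
        power2_eq_square field_simps)
qed

text \<open>The velocities and accelerations in \<open>nbody_solution\<close> are only asserted to
  exist; uniqueness of derivatives identifies them with the field and its derivative along the flow.
  For the acceleration, the velocities must agree near t and not only at t, which is where openness
  of \<open>I\<close> enters.\<close>

lemma parabolic_cyclic_solutionD:
  assumes sol: "parabolic_cyclic_solution R n m I w" and t: "t \<in> I" and k: "k \<in> {1..n}"
  shows "Im (w k t) > 0"
    and "Re (nbody_rhs R n m (\<lambda>i. w i t) k) = - 2 * Re (w k t) * (1 + (Re (w k t))\<^sup>2)"
    and "Im (nbody_rhs R n m (\<lambda>i. w i t) k)
      = (1 + (Re (w k t))\<^sup>2) * (2 * Im (w k t) + (1 + (Re (w k t))\<^sup>2) / Im (w k t))"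
proof -
  have field: "(w k has_vector_derivative parabolic_cyclic_field (w k s)) (at s)" if "s \<in> I" for s
    using sol that k unfolding parabolic_cyclic_solution_def by blast
  have "open I"
    using sol unfolding parabolic_cyclic_solution_def nbody_solution_def by blast
  show pos: "Im (w k t) > 0"
    using sol t k
    unfolding parabolic_cyclic_solution_def nbody_solution_def upper_half_plane_def by blast
  obtain w' w'' :: "nat \<Rightarrow> real \<Rightarrow> complex" where
    ex: "\<forall>t\<in>I. \<forall>k\<in>{1..n}.
        (w k has_vector_derivative w' k t) (at t) \<and>
        (w' k has_vector_derivative w'' k t) (at t) \<and>
        w'' k t - 2 * (w' k t)\<^sup>2 / (w k t - cnj (w k t)) = nbody_rhs R n m (\<lambda>i. w i t) k"
    using sol unfolding parabolic_cyclic_solution_def nbody_solution_def by blast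
  have w': "w' k s = parabolic_cyclic_field (w k s)" if "s \<in> I" for s
    using ex field[OF that] that k by (blast intro: vector_derivative_unique_at)
  have "(w' k has_vector_derivative parabolic_cyclic_acceleration (w k t)) (at t)"
    using has_vector_derivative_parabolic_cyclic_field[OF field[OF t]] \<open>open I\<close> t
    by (rule has_vector_derivative_transform_within_open) (simp add: w')
  then have w'': "w'' k t = parabolic_cyclic_acceleration (w k t)"
    using ex t k by (blast intro: vector_derivative_unique_at)
  have rhs: "nbody_rhs R n m (\<lambda>i. w i t) k = parabolic_cyclic_acceleration (w k t)
      - 2 * (parabolic_cyclic_field (w k t))\<^sup>2 / (w k t - cnj (w k t))"
    using ex t k by (simp add: w'[OF t, symmetric] w''[symmetric])
  show "Re (nbody_rhs R n m (\<lambda>i. w i t) k) = - 2 * Re (w k t) * (1 + (Re (w k t))\<^sup>2)"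
    and "Im (nbody_rhs R n m (\<lambda>i. w i t) k)
      = (1 + (Re (w k t))\<^sup>2) * (2 * Im (w k t) + (1 + (Re (w k t))\<^sup>2) / Im (w k t))"
    unfolding rhs
    using parabolic_cyclic_covariant_acceleration[of "w k t"] pos by auto
qed

text \<open>The translation balance holds at every time in \<open>I\<close>, so it may be
  differentiated. The numerator contributes 1 + 3 u^2 and the denominator - 4 u^2, which leaves the
  factor 1 - u^2.\<close>

lemma has_real_derivative_translation_balance:
  fixes z :: "real \<Rightarrow> complex"
  assumes "(z has_vector_derivative parabolic_cyclic_field (z t)) (at t)" and "Im (z t) \<noteq> 0"
  shows "((\<lambda>s. Re (z s) * (1 + (Re (z s))\<^sup>2) / (Im (z s))\<^sup>2) has_real_derivative
           (1 + (Re (z t))\<^sup>2) * (1 - (Re (z t))\<^sup>2) / (Im (z t))\<^sup>2) (at t)"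
proof -
  have u': "((\<lambda>s. Re (z s)) has_real_derivative 1 + (Re (z t))\<^sup>2) (at t)"
    and v': "((\<lambda>s. Im (z s)) has_real_derivative 2 * Re (z t) * Im (z t)) (at t)"
    using bounded_linear.has_vector_derivative[OF bounded_linear_Re assms(1)]
      bounded_linear.has_vector_derivative[OF bounded_linear_Im assms(1)]
    by (simp_all add: parabolic_cyclic_field_simps has_real_derivative_iff_has_vector_derivative)
  show ?thesis
    by (rule derivative_eq_intros u' v' refl)+
       (use assms(2) in \<open>simp_all add: field_simps power2_eq_square\<close>)
qed

section \<open>Contradiction between the differentiated translation balance and the dilation
  balance\<close>

theorem theorem2:
  fixes R :: real and n :: nat and m :: "nat \<Rightarrow> real"
  assumes "R > 0"
    and "n \<ge> 2"
    and "\<And>k. k \<in> {1..n} \<Longrightarrow> m k > 0"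
  shows "\<not> (\<exists>I w. parabolic_cyclic_solution R n m I w)"
proof
  assume "\<exists>I w. parabolic_cyclic_solution R n m I w"
  then obtain I w where sol: "parabolic_cyclic_solution R n m I w"
    by blast
  then have "open I" "I \<noteq> {}"
    and field: "\<And>t k. t \<in> I \<Longrightarrow> k \<in> {1..n} \<Longrightarrow>
      (w k has_vector_derivative parabolic_cyclic_field (w k t)) (at t)"
    unfolding parabolic_cyclic_solution_def nbody_solution_def by blast+
  then obtain t where t: "t \<in> I"
    by blast
  note D = parabolic_cyclic_solutionD[OF sol]
  have nz: "Im (w k s) \<noteq> 0" if "s \<in> I" "k \<in> {1..n}" for k s
    using D(1)[OF that] by simp
  define F where
    "F s = (\<Sum>k\<in>{1..n}. m k * (Re (w k s) * (1 + (Re (w k s))\<^sup>2) / (Im (w k s))\<^sup>2))" for s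
  define G where
    "G = (\<Sum>k\<in>{1..n}. m k * ((1 + (Re (w k t))\<^sup>2) * (1 - (Re (w k t))\<^sup>2) / (Im (w k t))\<^sup>2))"
  have F0: "F s = 0" if s: "s \<in> I" for s
  proof -
    have "0 = (\<Sum>k\<in>{1..n}. m k * Re (nbody_rhs R n m (\<lambda>i. w i s) k) / (Im (w k s))\<^sup>2)"
      using translation_momentum_balance[of n "\<lambda>i. w i s" m R] nz[OF s] by simp
    also have "\<dots> = - 2 * F s"
      unfolding F_def sum_distrib_left
      by (rule sum.cong) (simp_all add: D(2)[OF s])
    finally show ?thesis by simp
  qed
  have "(F has_real_derivative G) (at t)"
    unfolding F_def G_def
    by (intro DERIV_sum DERIV_cmult has_real_derivative_translation_balance field nz t)
  moreover have "(F has_real_derivative 0) (at t)"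
    by (rule has_field_derivative_transform_within_open[OF DERIV_const \<open>open I\<close> t])
       (simp add: F0)
  ultimately have G0: "G = 0"
    by (rule DERIV_unique)
  have "0 = (\<Sum>k\<in>{1..n}. m k * (Re (w k t) * Re (nbody_rhs R n m (\<lambda>i. w i t) k)
           + Im (w k t) * Im (nbody_rhs R n m (\<lambda>i. w i t) k)) / (Im (w k t))\<^sup>2)"
    using dilation_momentum_balance[of n "\<lambda>i. w i t" m R] nz[OF t] by simp
  \<comment> \<open>For each body the pairing with w is (1 + u^2) (1 - u^2 + 2 v^2). Division by v^2
    turns the last term into the v-free positive part and leaves the summand of
    \<open>G\<close>.\<close>
  also have "\<dots> = (\<Sum>k\<in>{1..n}. m k * ((1 + (Re (w k t))\<^sup>2) * (1 - (Re (w k t))\<^sup>2) / (Im (w k t))\<^sup>2)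
      + 2 * (m k * (1 + (Re (w k t))\<^sup>2)))"
    by (rule sum.cong[OF refl])
       (use nz[OF t] in \<open>simp add: D(2,3)[OF t] field_simps power2_eq_square\<close>)
  also have "\<dots> = G + 2 * (\<Sum>k\<in>{1..n}. m k * (1 + (Re (w k t))\<^sup>2))"
    unfolding G_def by (simp add: sum.distrib sum_distrib_left)
  finally have "(\<Sum>k\<in>{1..n}. m k * (1 + (Re (w k t))\<^sup>2)) = 0"
    using G0 by simp
  \<comment> \<open>Strict positivity needs a nonempty index set, which \<open>n \<ge> 2\<close>
    provides.\<close>
  moreover have "(\<Sum>k\<in>{1..n}. m k * (1 + (Re (w k t))\<^sup>2)) > 0"
    using assms(2,3) by (intro sum_pos mult_pos_pos) (auto simp: add_pos_nonneg)
  ultimately show False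
    by simp
qed

end
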